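(* Let $g>0$, $h_\ell,h_r>0$ and $u_\ell,u_r\in\mathbb{R}$ satisfy $u_r-u_\ell<2\sqrt{gh_\ell}+2\sqrt{gh_r}$, let $\phi$ be the associated depth function for the shallow water Riemann problem, let $h_*>0$ be the unique root of $\phi$ in $(0,\infty)$, and let $$h_{\mathrm{RR}}:=\frac{\left(u_\ell-u_r+2\sqrt{gh_\ell}+2\sqrt{gh_r}\right)^2}{16g}.$$ Then $h_*\le h_{\mathrm{RR}}$.
   Context: For $h>0$ the depth function is $\phi(h)=f(h;h_\ell)+f(h;h_r)+u_r-u_\ell$, where, for $s\in\{\ell,r\}$, $$f(h;h_s)=\begin{cases}2\left(\sqrt{gh}-\sqrt{gh_s}\right) & \text{if } h\le h_s,\\[4pt] (h-h_s)\sqrt{\tfrac12 g\,\dfrac{h+h_s}{h\,h_s}} & \text{if } h>h_s.\end{cases}$$ The condition $u_r-u_\ell<2\sqrt{gh_\ell}+2\sqrt{gh_r}$ says that no dry state occurs; under it $\phi$ has exactly one root $h_*$ in $(0,\infty)$, which is the depth of the intermediate state in the exact solution of the Riemann problem for the shallow water equations with left state $(h_\ell,u_\ell)$ and right state $(h_r,u_r)$. Here $g$ is the gravitational constant. *)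

theory Defs
  imports Complex_Main
begin

definition depth_branch :: "real \<Rightarrow> real \<Rightarrow> real \<Rightarrow> real" where
  "depth_branch g hs h =
     (if h \<le> hs then 2 * (sqrt (g * h) - sqrt (g * hs))
      else (h - hs) * sqrt (1 / 2 * g * ((h + hs) / (h * hs))))"

definition depth_fun :: "real \<Rightarrow> real \<Rightarrow> real \<Rightarrow> real \<Rightarrow> real \<Rightarrow> real \<Rightarrow> real" where
  "depth_fun g hl hr ul ur h = depth_branch g hl h + depth_branch g hr h + ur - ul"

(* The root of the depth function obtained when both waves are treated as rarefactions. *)
definition depth_RR :: "real \<Rightarrow> real \<Rightarrow> real \<Rightarrow> real \<Rightarrow> real \<Rightarrow> real" where
  "depth_RR g hl hr ul ur =
     (ul - ur + 2 * sqrt (g * hl) + 2 * sqrt (g * hr))\<^sup>2 / (16 * g)"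

lemma depth_branch_strict_mono:
  assumes g: "g > 0" and hs: "hs > 0" and a: "0 < a" and ab: "a < b"
  shows "depth_branch g hs a < depth_branch g hs b"
proof -
  consider "b \<le> hs" | "a \<le> hs" "hs < b" | "hs < a" by linarith
  then show ?thesis
  proof cases
    case 1
    then show ?thesis using ab g by (simp add: depth_branch_def)
  next
    case 2
    have "depth_branch g hs a \<le> 0" using 2 g by (simp add: depth_branch_def)
    also have "0 < depth_branch g hs b" using 2 g hs by (simp add: depth_branch_def)
    finally show ?thesis .
  next
    case 3
    have eq: "depth_branch g hs x = sqrt (g / (2 * hs) * ((x - hs) * (x - hs\<^sup>2 / x)))"
      if "hs < x" for x
    proof -
      have "depth_branch g hs x = sqrt ((x - hs)\<^sup>2) * sqrt (1 / 2 * g * ((x + hs) / (x * hs)))"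
        using that by (simp add: depth_branch_def)
      also have "\<dots> = sqrt ((x - hs)\<^sup>2 * (1 / 2 * g * ((x + hs) / (x * hs))))"
        by (simp only: real_sqrt_mult)
      also have "(x - hs)\<^sup>2 * (1 / 2 * g * ((x + hs) / (x * hs)))
          = g / (2 * hs) * ((x - hs) * (x - hs\<^sup>2 / x))"
        using that hs by (simp add: field_simps power2_eq_square)
      finally show ?thesis .
    qed
    have "hs\<^sup>2 / a < a" using 3 hs a by (simp add: field_simps power2_eq_square mult_strict_mono)
    moreover have "hs\<^sup>2 / b < hs\<^sup>2 / a" using a ab hs by (simp add: divide_strict_left_mono)
    ultimately have "(a - hs) * (a - hs\<^sup>2 / a) < (b - hs) * (b - hs\<^sup>2 / b)"
      using 3 ab by (intro mult_strict_mono) auto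
    then have "g / (2 * hs) * ((a - hs) * (a - hs\<^sup>2 / a))
        < g / (2 * hs) * ((b - hs) * (b - hs\<^sup>2 / b))"
      using g hs by (intro mult_strict_left_mono) auto
    then show ?thesis
      using 3 ab by (simp only: eq real_sqrt_less_iff less_trans[OF 3 ab])
  qed
qed

lemma continuous_on_depth_branch:
  assumes hs: "hs > 0"
  shows "continuous_on {0<..} (depth_branch g hs)"
proof -
  have "continuous_on ({..hs} \<union> {hs..})
     (\<lambda>h. if h \<le> hs then 2 * (sqrt (g * h) - sqrt (g * hs))
      else (h - hs) * sqrt (1 / 2 * g * ((h + hs) / (h * hs))))"
    using hs by (intro continuous_on_If continuous_intros) auto
  then have "continuous_on ({..hs} \<union> {hs..}) (depth_branch g hs)"
    by (simp add: depth_branch_def[abs_def])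
  then show ?thesis by (rule continuous_on_subset) auto
qed

(* The root of the depth function exists and is unique, so that speaking of
   "the" intermediate depth is justified. *)
lemma depth_fun_root_ex1:
  assumes g: "g > 0" and hl: "hl > 0" and hr: "hr > 0"
    and dry: "ur - ul < 2 * sqrt (g * hl) + 2 * sqrt (g * hr)"
  shows "\<exists>!h. h > 0 \<and> depth_fun g hl hr ul ur h = 0"
proof -
  let ?f = "depth_fun g hl hr ul ur"
  have mono: "?f a < ?f b" if "0 < a" "a < b" for a b
    using depth_branch_strict_mono[OF g hl that] depth_branch_strict_mono[OF g hr that]
    by (simp add: depth_fun_def)
  have cont: "continuous_on {0<..} ?f"
    unfolding depth_fun_def by (intro continuous_intros continuous_on_depth_branch hl hr)
  define d where "d = 2 * sqrt (g * hl) + 2 * sqrt (g * hr) - (ur - ul)"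
  define a where "a = min (min hl hr) ((d / 8)\<^sup>2 / g)"
  have d: "d > 0" using dry by (simp add: d_def)
  have a: "a > 0" using d g hl hr by (simp add: a_def)
  have "g * a \<le> (d / 8)\<^sup>2"
    using g mult_left_mono[of a "(d / 8)\<^sup>2 / g" g] by (simp add: a_def)
  then have "sqrt (g * a) \<le> d / 8" using d by (intro real_le_lsqrt) auto
  moreover have "a \<le> hl" "a \<le> hr" by (auto simp: a_def)
  ultimately have fa: "?f a < 0"
    using d by (simp add: depth_fun_def depth_branch_def d_def)
  define c where "c = sqrt (g / (2 * hl))"
  define b where "b = max hl hr + 1 + \<bar>ur - ul\<bar> / c"
  have c: "c > 0" using g hl by (simp add: c_def)
  have q: "\<bar>ur - ul\<bar> / c \<ge> 0" using c by simp
  have bl: "b > hl" and br: "b > hr" using q by (auto simp: b_def)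
  have "g / (2 * hl) \<le> 1 / 2 * g * ((b + hl) / (b * hl))"
    using g hl bl by (simp add: field_simps)
  then have "c \<le> sqrt (1 / 2 * g * ((b + hl) / (b * hl)))"
    unfolding c_def by (rule real_sqrt_le_mono)
  then have "(b - hl) * c \<le> depth_branch g hl b"
    using bl by (simp add: depth_branch_def)
  moreover have "\<bar>ur - ul\<bar> / c \<le> b - hl" by (auto simp: b_def)
  then have "\<bar>ur - ul\<bar> \<le> (b - hl) * c" using c by (simp add: field_simps)
  moreover have "depth_branch g hr b > 0" using br g hr by (simp add: depth_branch_def)
  ultimately have fb: "?f b > 0" by (simp add: depth_fun_def)
  have ab: "a \<le> b" using bl by (auto simp: a_def)
  have "continuous_on {a..b} ?f" using cont a by (auto intro: continuous_on_subset)
  then obtain h where h: "a \<le> h" "?f h = 0" using IVT'[of ?f a 0 b] fa fb ab by auto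
  show ?thesis
  proof (rule ex1I[of _ h])
    show "h > 0 \<and> ?f h = 0" using a h by simp
    show "y = h" if "y > 0 \<and> ?f y = 0" for y
      using mono[of y h] mono[of h y] that a h by (cases y h rule: linorder_cases) auto
  qed
qed

end

(* Replacing each shock branch by the rarefaction formula can only decrease the depth function,
   so a root of it satisfies 4 sqrt (g h) \<le> ul - ur + 2 sqrt (g hl) + 2 sqrt (g hr);
   squaring gives the bound. *)
theory Submission
  imports Defs
begin

text \<open>On the shock side, put \<open>p = sqrt (g * h)\<close> and
  \<open>q = sqrt (g * hs)\<close>. Since \<open>h - hs = (p - q) * (p + q) / g\<close>, it suffices
  that the square root in the shock formula is at least \<open>2 * g / (p + q)\<close>. Squared,
  this is a polynomial inequality in \<open>p\<close> and \<open>q\<close>.\<close>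

lemma depth_branch_ge_rarefaction:
  assumes g: "g > 0" and hs: "hs > 0"
  shows "2 * (sqrt (g * h) - sqrt (g * hs)) \<le> depth_branch g hs h"
proof (cases "h \<le> hs")
  case True
  then show ?thesis by (simp add: depth_branch_def)
next
  case False
  define p q where "p = sqrt (g * h)" and "q = sqrt (g * hs)"
  let ?X = "1 / 2 * g * ((h + hs) / (h * hs))"
  have pos: "0 < p" "0 < q"
    using False g hs by (auto simp: p_def q_def)
  have p2: "p\<^sup>2 = g * h" and q2: "q\<^sup>2 = g * hs"
    using False g hs by (auto simp: p_def q_def)
  have h: "h = p\<^sup>2 / g" "hs = q\<^sup>2 / g"
    using g p2 q2 by auto
  have X: "?X = g\<^sup>2 * (p\<^sup>2 + q\<^sup>2) / (2 * (p * q)\<^sup>2)"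
    using g pos by (simp add: h field_simps power2_eq_square)
  \<comment> \<open>The product of two forms of the AM-GM inequality, both amounting to
    \<open>(p - q)\<^sup>2 \<ge> 0\<close>.\<close>
  have "(2 * (p * q)) * (4 * (p * q)) \<le> (p\<^sup>2 + q\<^sup>2) * (p + q)\<^sup>2"
  proof (rule mult_mono)
    show "2 * (p * q) \<le> p\<^sup>2 + q\<^sup>2"
      using sum_squares_bound[of p q] by simp
    then show "4 * (p * q) \<le> (p + q)\<^sup>2"
      by (simp add: power2_sum)
  qed (use pos in auto)
  then have "8 * (p * q)\<^sup>2 \<le> (p\<^sup>2 + q\<^sup>2) * (p + q)\<^sup>2"
    by (simp add: power2_eq_square)
  \<comment> \<open>Cross-multiplication: \<open>frac_le_eq\<close> leaves a quotient whose
    numerator is the difference of the two sides above.\<close>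
  then have "4 / (p + q)\<^sup>2 \<le> (p\<^sup>2 + q\<^sup>2) / (2 * (p * q)\<^sup>2)"
    using pos by (subst frac_le_eq) (auto intro!: divide_nonpos_pos)
  from mult_left_mono[OF this, of "g\<^sup>2"] have "(2 * g / (p + q))\<^sup>2 \<le> ?X"
    unfolding X by (simp add: power_divide power_mult_distrib mult_ac)
  then have "2 * g / (p + q) \<le> sqrt ?X"
    by (rule real_le_rsqrt)
  then have "(h - hs) * (2 * g / (p + q)) \<le> depth_branch g hs h"
    using False by (simp add: depth_branch_def mult_left_mono del: times_divide_eq_right)
  also have "(h - hs) * (2 * g / (p + q)) = 2 * (p - q)"
  proof -
    have "h - hs = (p - q) * (p + q) / g"
      using g by (simp add: h field_simps power2_eq_square)
    moreover have "p + q \<noteq> 0" using pos by simp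
    ultimately show ?thesis using g by (simp del: distrib_right_numeral)
  qed
  finally show ?thesis by (simp only: p_def q_def)
qed

theorem lemma2p1:
  fixes g hl hr ul ur hstar :: real
  assumes "g > 0" and "hl > 0" and "hr > 0"
    and "ur - ul < 2 * sqrt (g * hl) + 2 * sqrt (g * hr)"
    and "hstar > 0" and "depth_fun g hl hr ul ur hstar = 0"
  shows "hstar \<le> depth_RR g hl hr ul ur"
proof -
  let ?S = "ul - ur + 2 * sqrt (g * hl) + 2 * sqrt (g * hr)"
  \<comment> \<open>The two rarefaction bounds add up to
    \<open>4 * sqrt (g * hstar) - ?S \<le> 0\<close>, the depth function being zero at
    \<open>hstar\<close>.\<close>
  have "4 * sqrt (g * hstar) \<le> ?S"
    using depth_branch_ge_rarefaction[OF assms(1,2), of hstar]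
      depth_branch_ge_rarefaction[OF assms(1,3), of hstar] assms(6)
    by (simp add: depth_fun_def)
  \<comment> \<open>Squaring keeps the order because the smaller side is nonnegative; its square is
    \<open>16 * g * hstar\<close>.\<close>
  then have "(4 * sqrt (g * hstar))\<^sup>2 \<le> ?S\<^sup>2"
    using assms by (intro power_mono) auto
  then show ?thesis
    using assms by (simp add: depth_RR_def power_mult_distrib pos_le_divide_eq mult_ac)
qed

end
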